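(* There is an absolute constant $c>0$ such that the following holds. Let $m\le n$ and $k$ be positive integers and let $\mathcal{H}$ be an $m\times n$ half-grid. If $\mathcal{L}$ is a finite multiset of lines in $\mathbb{R}^2$ such that every point of $\mathcal{H}$ lies on at least $k$ lines of $\mathcal{L}$ (counted with multiplicity), then $$|\mathcal{L}|\ \ge\ mk\left(1-e^{-\frac{n}{m}}-c\,\frac{n}{m^2}\right).$$ That is, the minimum number of lines required to cover every point of $\mathcal{H}$ at least $k$ times is at least $mk\left(1-e^{-n/m}-O(\frac{n}{m^2})\right)$.
   Context: Let $S_1=\{a_0<a_1<\cdots<a_{n-1}\}$ and $S_2=\{b_0<b_1<\cdots<b_{m-1}\}$ be sets of real numbers of sizes $n$ and $m$ with $m\le n$. The ($m\times n$) half-grid defined by $S_1$ and $S_2$ is the set of points $(a_i,b_j)\in\mathbb{R}^2$ with $0\le i\le n-1$, $0\le j\le m-1$ and $(m-1)i+(n-1)j\le (m-1)(n-1)$. Lines may be repeated in a covering; the number of lines is counted with multiplicity. *)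

theory Defs
  imports "HOL-Analysis.Analysis" "HOL-Library.Multiset"
begin

(* Only used with m, n \<ge> 1 (an empty index range otherwise), so the natural-number
   subtractions never truncate. *)
definition half_grid :: "nat \<Rightarrow> nat \<Rightarrow> (nat \<Rightarrow> real) \<Rightarrow> (nat \<Rightarrow> real) \<Rightarrow> (real \<times> real) set" where
  "half_grid m n a b =
    {(a i, b j) | i j. i < n \<and> j < m \<and> (m - 1) * i + (n - 1) * j \<le> (m - 1) * (n - 1)}"

(* The sets {a 0 < ... < a (n-1)} and {b 0 < ... < b (m-1)} are given by their increasing
   enumerations; the values of a and b beyond these ranges are irrelevant. *)
definition is_half_grid :: "nat \<Rightarrow> nat \<Rightarrow> (real \<times> real) set \<Rightarrow> bool" where
  "is_half_grid m n H \<longleftrightarrow>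
    (\<exists>a b. strict_mono_on {..<n} a \<and> strict_mono_on {..<m} b \<and> H = half_grid m n a b)"

definition is_line :: "(real \<times> real) set \<Rightarrow> bool" where
  "is_line l \<longleftrightarrow> affine l \<and> aff_dim l = 1"

definition covers_at_least :: "nat \<Rightarrow> (real \<times> real) set multiset \<Rightarrow> (real \<times> real) set \<Rightarrow> bool" where
  "covers_at_least k L H \<longleftrightarrow> (\<forall>p\<in>H. k \<le> size {#l \<in># L. p \<in> l#})"

end

theory Submission
  imports Defs
begin

text \<open>
  Linear programming duality: give every point of the half-grid in row \<open>j < J\<close> the weight
  \<open>1 / r\<^sub>j\<close>, where \<open>r\<^sub>j\<close> is the number of points of that row, and all other points weight \<open>0\<close>.
  A horizontal line then has weight at most \<open>1\<close>, and any other line meets each row at most once,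
  so its weight is at most \<open>\<Sum>j<J. 1 / r\<^sub>j\<close>. As long as this sum is at most \<open>1\<close>, a \<open>k\<close>-fold
  cover needs at least \<open>k\<close> times the total weight, that is \<open>k * J\<close>, lines. Since
  \<open>r\<^sub>j \<ge> (n - 1) * (m - 1 - j) / (m - 1)\<close>, comparing the harmonic sum with the logarithm shows
  that \<open>J = \<lfloor>(m - 1) * (1 - exp (- (n - 1) / (m - 1)))\<rfloor>\<close> is admissible.
\<close>

section \<open>Weighted covers and lines in the plane\<close>

text \<open>Weak duality by double counting: weighting each point by its covering multiplicity and
  summing line by line, every line contributes its own weight, which is at most 1. Points are
  indexed through \<open>f\<close>, so weights can be put on index pairs.\<close>

lemma weighted_cover_bound:
  fixes w :: "'i \<Rightarrow> real" and f :: "'i \<Rightarrow> 'p" and L :: "'p set multiset"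
  assumes fin: "finite P"
    and nonneg: "\<And>p. p \<in> P \<Longrightarrow> w p \<ge> 0"
    and light: "\<And>l. l \<in># L \<Longrightarrow> (\<Sum>p\<in>{p\<in>P. f p \<in> l}. w p) \<le> 1"
    and cover: "\<And>p. p \<in> P \<Longrightarrow> k \<le> size {#l \<in># L. f p \<in> l#}"
  shows "real k * (\<Sum>p\<in>P. w p) \<le> real (size L)"
proof -
  have "real k * (\<Sum>p\<in>P. w p) = (\<Sum>p\<in>P. w p * real k)"
    by (simp add: sum_distrib_left mult.commute)
  also have "\<dots> \<le> (\<Sum>p\<in>P. w p * real (size {#l \<in># L. f p \<in> l#}))"
    by (intro sum_mono mult_left_mono) (use cover nonneg in auto)
  also have "\<dots> \<le> real (size L)"
    using light
  proof (induction L)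
    case empty
    then show ?case by simp
  next
    case (add l L)
    have "(\<Sum>p\<in>P. w p * real (size {#l' \<in># add_mset l L. f p \<in> l'#}))
        = (\<Sum>p\<in>P. w p * real (size {#l' \<in># L. f p \<in> l'#}) + (if f p \<in> l then w p else 0))"
      by (intro sum.cong) (auto simp: algebra_simps)
    also have "\<dots> = (\<Sum>p\<in>P. w p * real (size {#l' \<in># L. f p \<in> l'#})) + (\<Sum>p\<in>{p\<in>P. f p \<in> l}. w p)"
      by (simp add: sum.distrib sum.inter_filter fin)
    also have "\<dots> \<le> real (size L) + 1"
      by (intro add_mono add.IH add.prems) auto
    finally show ?case by simp
  qed
  finally show ?thesis .
qed

text \<open>Two distinct points of \<open>l\<close> already span it, since its dimension is 1. If
  they share their second coordinate, so do all their affine combinations.\<close>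

lemma line_horizontal_or_inj_snd:
  assumes "is_line l"
  shows "(\<exists>y. \<forall>p\<in>l. snd p = y) \<or> inj_on snd l"
proof (rule disjCI)
  assume "\<not> inj_on snd l"
  then obtain p q where pq: "p \<in> l" "q \<in> l" "snd p = snd q" "p \<noteq> q"
    by (auto simp: inj_on_def)
  have "affine hull {p, q} = affine hull l"
    using assms pq by (subst aff_dim_eq_full_gen[symmetric]) (auto simp: is_line_def aff_dim_2)
  also have "\<dots> = l"
    using assms by (simp add: is_line_def affine_hull_eq)
  finally have l: "l = affine hull {p, q}" ..
  have "snd x = snd q" if "x \<in> l" for x
    using that pq(3) by (auto simp: l affine_hull_2 simp flip: distrib_right)
  then show "\<exists>y. \<forall>p\<in>l. snd p = y" by blast
qed

text \<open>The sum telescopes: \<open>ln x \<le> x - 1\<close> at \<open>x = (t - 1) / t\<close>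
  bounds each term \<open>1 / t\<close> by \<open>ln t - ln (t - 1)\<close>.\<close>

lemma sum_inverse_le_ln:
  fixes J M :: nat
  assumes "J < M"
  shows "(\<Sum>j<J. 1 / (real M - real j)) \<le> ln (real M / (real M - real J))"
  using assms
proof (induction J)
  case 0
  then show ?case by simp
next
  case (Suc J)
  define t where "t = real M - real J"
  have t: "t > 1" using Suc.prems by (simp add: t_def)
  have M: "real M > 0" using Suc.prems by simp
  have "ln ((t - 1) / t) \<le> (t - 1) / t - 1"
    using t by (intro ln_le_minus_one) auto
  then have *: "1 / t \<le> ln t - ln (t - 1)"
    using t by (simp add: ln_div field_simps)
  have "(\<Sum>j<Suc J. 1 / (real M - real j)) \<le> ln (real M / t) + 1 / t"
    using Suc by (simp add: t_def)
  also have "\<dots> \<le> ln (real M / (t - 1))"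
    using * t M by (simp add: ln_div)
  also have "t - 1 = real M - real (Suc J)" by (simp add: t_def)
  finally show ?case .
qed

section \<open>Sizes of the rows of the half-grid\<close>

text \<open>A row is recorded by its column indices, so its size, and hence every weight, depends
  only on \<open>m\<close>, \<open>n\<close> and \<open>j\<close>, not on the coordinates.\<close>

definition row_indices :: "nat \<Rightarrow> nat \<Rightarrow> nat \<Rightarrow> nat set" where
  "row_indices m n j = {i. i < n \<and> (m - 1) * i + (n - 1) * j \<le> (m - 1) * (n - 1)}"

lemma finite_row_indices [simp]: "finite (row_indices m n j)"
  by (simp add: row_indices_def)

text \<open>The row contains the indices from 0 to the rounded-down quotient \<open>q\<close>;
  counting index 0 as well makes up for the rounding.\<close>

lemma card_row_indices_ge:
  assumes "m \<ge> 2" "n \<ge> 1" "j < m"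
  shows "real (card (row_indices m n j)) \<ge> real (n - 1) * (real (m - 1) - real j) / real (m - 1)"
proof -
  define q where "q = (n - 1) * (m - 1 - j) div (m - 1)"
  have q: "(m - 1) * q \<le> (n - 1) * (m - 1 - j)"
    by (simp add: q_def)
  also have "\<dots> \<le> (n - 1) * (m - 1)" by (intro mult_le_mono2) simp
  finally have "q \<le> n - 1"
    using assms by (simp add: mult.commute)
  have "{..q} \<subseteq> row_indices m n j"
  proof
    fix i assume "i \<in> {..q}"
    then have i: "i \<le> q" by simp
    have "(m - 1) * i + (n - 1) * j \<le> (m - 1) * q + (n - 1) * j"
      using i by simp
    also have "\<dots> \<le> (n - 1) * (m - 1 - j) + (n - 1) * j"
      using q by simp
    also have "\<dots> = (n - 1) * (m - 1)"
      using assms by (simp flip: distrib_left)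
    finally show "i \<in> row_indices m n j"
      using i \<open>q \<le> n - 1\<close> assms by (simp add: row_indices_def mult.commute)
  qed
  then have "q + 1 \<le> card (row_indices m n j)"
    using card_mono[of "row_indices m n j" "{..q}"] by simp
  moreover have "(n - 1) * (m - 1 - j) < (m - 1) * (q + 1)"
    using assms dividend_less_times_div[of "m - 1" "(n - 1) * (m - 1 - j)"]
    by (simp add: q_def algebra_simps)
  ultimately have "(n - 1) * (m - 1 - j) \<le> (m - 1) * card (row_indices m n j)"
    by (meson less_imp_le_nat mult_le_mono2 order_trans)
  then have "real ((n - 1) * (m - 1 - j)) \<le> real ((m - 1) * card (row_indices m n j))"
    by (rule of_nat_mono)
  then have "real (n - 1) * (real (m - 1) - real j) \<le> real (m - 1) * real (card (row_indices m n j))"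
    using assms by (simp add: of_nat_diff diff_diff_eq)
  then show ?thesis
    using assms by (simp add: divide_le_eq mult.commute)
qed

lemma half_grid_cover_ge_rows:
  assumes a: "strict_mono_on {..<n} a" and b: "strict_mono_on {..<m} b"
    and lines: "\<forall>l\<in>#L. is_line l"
    and cover: "covers_at_least k L (half_grid m n a b)"
    and J: "J \<le> m"
    and nonempty: "\<And>j. j < J \<Longrightarrow> card (row_indices m n j) > 0"
    and sum_le: "(\<Sum>j<J. 1 / real (card (row_indices m n j))) \<le> 1"
  shows "real k * real J \<le> real (size L)"
proof -
  define P where "P = Sigma {..<J} (row_indices m n)"
  define f where "f = (\<lambda>(j, i). (a i, b j))"
  define w where "w = (\<lambda>(j, i::nat). 1 / real (card (row_indices m n j)))"
  have inja: "inj_on a {..<n}" and injb: "inj_on b {..<m}"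
    using a b by (auto intro: strict_mono_on_imp_inj_on)
  have light: "(\<Sum>p\<in>{p\<in>P. f p \<in> l}. w p) \<le> 1" if "l \<in># L" for l
  proof -
    have "is_line l" using lines that by simp
    define N where "N = (\<lambda>j. {i \<in> row_indices m n j. (a i, b j) \<in> l})"
    have "{p\<in>P. f p \<in> l} = Sigma {..<J} N"
      by (auto simp: P_def f_def N_def)
    then have "(\<Sum>p\<in>{p\<in>P. f p \<in> l}. w p) = (\<Sum>p\<in>Sigma {..<J} N. w p)"
      by simp
    also have "\<dots> = (\<Sum>j<J. real (card (N j)) / real (card (row_indices m n j)))"
      unfolding w_def by (subst sum.Sigma[symmetric]) (auto simp: N_def)
    finally have eq: "(\<Sum>p\<in>{p\<in>P. f p \<in> l}. w p)
        = (\<Sum>j<J. real (card (N j)) / real (card (row_indices m n j)))" .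
    consider (horizontal) y where "\<forall>p\<in>l. snd p = y" | (inj) "inj_on snd l"
      using line_horizontal_or_inj_snd[OF \<open>is_line l\<close>] by metis
    then show ?thesis
    proof cases
      \<comment> \<open>Since \<open>b\<close> is injective, the line meets at most one of the first
        \<open>J\<close> rows, and a full row weighs 1.\<close>
      case horizontal
      show ?thesis
      proof (cases "\<exists>j<J. b j = y")
        case True
        then obtain j0 where j0: "j0 < J" "b j0 = y" by blast
        have "N j = {}" if "j < J" "j \<noteq> j0" for j
        proof -
          have "b j \<noteq> y"
            using that j0 J injb by (metis inj_onD lessThan_iff less_le_trans)
          then show ?thesis using horizontal by (auto simp: N_def)
        qed
        then have "(\<Sum>j<J. real (card (N j)) / real (card (row_indices m n j)))
            = (\<Sum>j\<in>{j0}. real (card (N j)) / real (card (row_indices m n j)))"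
          using j0 by (intro sum.mono_neutral_right) auto
        also have "\<dots> \<le> 1"
          using card_mono[of "row_indices m n j0" "N j0"] nonempty[OF j0(1)]
          by (auto simp: N_def divide_le_eq)
        finally show ?thesis using eq by simp
      next
        case False
        then have "N j = {}" if "j < J" for j
          using horizontal that by (fastforce simp: N_def)
        then show ?thesis by (simp add: eq)
      qed
    next
      case inj
      \<comment> \<open>Points of \<open>l\<close> in the same row agree in \<open>snd\<close>,
        hence coincide; injectivity of \<open>a\<close> then identifies their indices.\<close>
      have "card (N j) \<le> 1" for j
      proof -
        have "i = i'" if "i \<in> N j" "i' \<in> N j" for i i'
        proof -
          have "(a i, b j) = (a i', b j)"
            using that by (intro inj_onD[OF inj]) (auto simp: N_def)
          then show ?thesis
            using that by (intro inj_onD[OF inja]) (auto simp: N_def row_indices_def)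
        qed
        moreover have "finite (N j)" by (simp add: N_def)
        ultimately show ?thesis by (auto simp: card_le_Suc0_iff_eq)
      qed
      then have "(\<Sum>j<J. real (card (N j)) / real (card (row_indices m n j)))
          \<le> (\<Sum>j<J. 1 / real (card (row_indices m n j)))"
        by (intro sum_mono divide_right_mono) (auto simp: of_nat_le_1_iff)
      then show ?thesis using eq sum_le by simp
    qed
  qed
  have "real k * (\<Sum>p\<in>P. w p) \<le> real (size L)"
  proof (rule weighted_cover_bound[where f = f])
    show "finite P" by (simp add: P_def)
    show "w p \<ge> 0" for p by (simp add: w_def split: prod.split)
    show "(\<Sum>p\<in>{p\<in>P. f p \<in> l}. w p) \<le> 1" if "l \<in># L" for l
      using light that .
    show "k \<le> size {#l \<in># L. f p \<in> l#}" if "p \<in> P" for p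
    proof -
      have "f p \<in> half_grid m n a b"
        using that J by (fastforce simp: P_def f_def half_grid_def row_indices_def)
      then show ?thesis using cover by (simp add: covers_at_least_def)
    qed
  qed
  also have "(\<Sum>p\<in>P. w p) = (\<Sum>j<J. \<Sum>i\<in>row_indices m n j. 1 / real (card (row_indices m n j)))"
    unfolding P_def w_def by (subst sum.Sigma) auto
  also have "\<dots> = (\<Sum>j<J. 1)"
    using nonempty by (intro sum.cong) (auto simp: card_gt_0_iff)
  finally show ?thesis by simp
qed

text \<open>The additive loss 2 has two sources: rounding \<open>J\<close> down costs at most 1, and
  replacing \<open>m\<close> by \<open>m - 1\<close> costs \<open>1 - exp (- (n / m))\<close>, which
  is below 1.\<close>

lemma half_grid_cover_bound:
  assumes m: "m \<ge> 1" and mn: "m \<le> n" and H: "is_half_grid m n H"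
    and lines: "\<forall>l\<in>#L. is_line l" and cover: "covers_at_least k L H"
  shows "real k * (real m * (1 - exp (- (real n / real m))) - 2) \<le> real (size L)"
proof (cases "m = 1")
  case True
  \<comment> \<open>The ratio \<open>(n - 1) / (m - 1)\<close> is meaningless for
    \<open>m = 1\<close>, but there the claimed bound is not even positive.\<close>
  have "real k * (real m * (1 - exp (- (real n / real m))) - 2) \<le> 0"
    using exp_gt_zero[of "- real n"]
    by (intro mult_nonneg_nonpos) (auto simp: True simp del: exp_gt_zero)
  then show ?thesis by linarith
next
  case False
  define M N where "M = m - 1" and "N = n - 1"
  have M: "M \<ge> 1" and N: "N \<ge> M" and m_eq: "real m = real M + 1" and n_eq: "real n = real N + 1"
    using m mn False by (auto simp: M_def N_def)
  obtain a b where ab: "strict_mono_on {..<n} a" "strict_mono_on {..<m} b" "H = half_grid m n a b"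
    using H by (auto simp: is_half_grid_def)
  define e where "e = exp (- (real N / real M))"
  \<comment> \<open>The condition \<open>J \<le> M * (1 - e)\<close> amounts to
    \<open>M / (M - J) \<le> 1 / e = exp (N / M)\<close>. The logarithm is then at most
    \<open>N / M\<close>, which cancels the factor \<open>M / N\<close> in front of the harmonic
    sum.\<close>
  define J where "J = nat \<lfloor>real M * (1 - e)\<rfloor>"
  have e: "0 < e" "e < 1" using M N by (auto simp: e_def)
  have J_le: "real J \<le> real M * (1 - e)"
    using e by (simp add: J_def)
  have J_ge: "real J \<ge> real M * (1 - e) - 1"
    unfolding J_def by linarith
  have "real M * (1 - e) < real M" using e M by simp
  then have JM: "J < M" using J_le by linarith
  have row_ge: "real (card (row_indices m n j)) \<ge> real N * (real M - real j) / real M"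
    and row_pos: "real N * (real M - real j) / real M > 0" if "j < J" for j
    using card_row_indices_ge[of m n j] that JM M N m mn by (auto simp: M_def N_def)
  have "(\<Sum>j<J. 1 / real (card (row_indices m n j))) \<le> (\<Sum>j<J. real M / real N * (1 / (real M - real j)))"
  proof (rule sum_mono)
    fix j assume "j \<in> {..<J}"
    then have "j < J" by simp
    then have "1 / real (card (row_indices m n j)) \<le> 1 / (real N * (real M - real j) / real M)"
      using row_ge row_pos by (intro frac_le) auto
    then show "1 / real (card (row_indices m n j)) \<le> real M / real N * (1 / (real M - real j))"
      by simp
  qed
  also have "\<dots> = real M / real N * (\<Sum>j<J. 1 / (real M - real j))"
    by (simp add: sum_distrib_left)
  also have "\<dots> \<le> real M / real N * ln (real M / (real M - real J))"
    by (intro mult_left_mono sum_inverse_le_ln JM) auto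
  also have "\<dots> \<le> real M / real N * (real N / real M)"
  proof (intro mult_left_mono)
    have "real M * e \<le> real M - real J"
      using J_le by (simp add: algebra_simps)
    then have "real M / (real M - real J) \<le> 1 / e"
      using e JM by (simp add: field_simps)
    also have "1 / e = exp (real N / real M)"
      by (simp add: e_def exp_minus field_simps)
    finally have "ln (real M / (real M - real J)) \<le> ln (exp (real N / real M))"
      using JM M by (subst ln_le_cancel_iff) auto
    then show "ln (real M / (real M - real J)) \<le> real N / real M" by simp
  qed auto
  also have "\<dots> = 1" using M N by simp
  finally have "(\<Sum>j<J. 1 / real (card (row_indices m n j))) \<le> 1" .
  moreover have "card (row_indices m n j) > 0" if "j < J" for j
    using row_ge[OF that] row_pos[OF that] by linarith
  ultimately have main: "real k * real J \<le> real (size L)"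
    using ab lines cover JM by (intro half_grid_cover_ge_rows[of n a m b]) (auto simp: M_def)
  \<comment> \<open>As \<open>M \<le> N\<close>, adding 1 to numerator and denominator does not
    increase the ratio, so passing from \<open>N / M\<close> to \<open>n / m\<close> can only weaken
    the bound.\<close>
  have "real n / real m \<le> real N / real M"
    using M N by (simp add: m_eq n_eq field_simps)
  then have "e \<le> exp (- (real n / real m))" by (simp add: e_def)
  then have "real M * (1 - exp (- (real n / real m))) \<le> real M * (1 - e)"
    by (intro mult_left_mono) auto
  moreover have "exp (- (real n / real m)) > 0" by simp
  moreover have "real m * (1 - exp (- (real n / real m)))
      = real M * (1 - exp (- (real n / real m))) + (1 - exp (- (real n / real m)))"
    by (simp add: m_eq algebra_simps)
  ultimately have "real m * (1 - exp (- (real n / real m))) - 2 \<le> real J"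
    using J_ge by linarith
  then have "real k * (real m * (1 - exp (- (real n / real m))) - 2) \<le> real k * real J"
    by (rule mult_left_mono) simp
  then show ?thesis using main by linarith
qed

theorem theorem1p2:
  shows "\<exists>c::real. c > 0 \<and>
    (\<forall>(m::nat) (n::nat) (k::nat) (H::(real \<times> real) set) (L::(real \<times> real) set multiset).
      1 \<le> m \<longrightarrow> m \<le> n \<longrightarrow> 1 \<le> k \<longrightarrow> is_half_grid m n H \<longrightarrow>
      (\<forall>l\<in>#L. is_line l) \<longrightarrow> covers_at_least k L H \<longrightarrow>
      real (size L) \<ge>
        real m * real k * (1 - exp (- (real n / real m)) - c * (real n / (real m)\<^sup>2)))"
proof (intro exI[of _ 2] conjI allI impI)
  fix m n k :: nat and H :: "(real \<times> real) set" and L :: "(real \<times> real) set multiset"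
  assume m: "1 \<le> m" and mn: "m \<le> n" and hyps: "is_half_grid m n H" "\<forall>l\<in>#L. is_line l"
    "covers_at_least k L H"
  have "real m * (real n / (real m)\<^sup>2) = real n / real m"
    using m by (simp add: power2_eq_square)
  then have "real m * (1 - exp (- (real n / real m)) - 2 * (real n / (real m)\<^sup>2))
      = real m * (1 - exp (- (real n / real m))) - 2 * (real n / real m)"
    by (simp only: right_diff_distrib mult.left_commute[of _ 2])
  \<comment> \<open>Here \<open>m \<le> n\<close> gives \<open>n / m \<ge> 1\<close>, so the error
    term with \<open>c = 2\<close> absorbs the additive loss 2.\<close>
  also have "\<dots> \<le> real m * (1 - exp (- (real n / real m))) - 2"
    using m mn by (simp add: le_divide_eq)
  finally have "real k * (real m * (1 - exp (- (real n / real m)) - 2 * (real n / (real m)\<^sup>2)))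
      \<le> real k * (real m * (1 - exp (- (real n / real m))) - 2)"
    by (rule mult_left_mono) simp
  also have "\<dots> \<le> real (size L)"
    by (rule half_grid_cover_bound[OF m mn hyps])
  finally show "real (size L) \<ge>
      real m * real k * (1 - exp (- (real n / real m)) - 2 * (real n / (real m)\<^sup>2))"
    by (simp add: mult_ac)
qed simp

end
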